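(* Suppose $q\ge 3$, $D\subset F_q^*$ and $1\not\in D$. Suppose $\mathcal B$ is a system modulo $q$ such that for each $a\in D$ the set $z(a,1)$ is nonempty. Then $\mathcal B$ is a barrier for the following statement about a family $\mathcal F=(F_{q,a})_{a\in F_q^*}$: for all sufficiently large $x$ there exists $a\in D$ such that $$F_{q,1}(x)\ge \frac{F_{q,a}(x)+F_{q,a^{-1}}(x)}{2}.$$
   Context: Let $q\ge 3$ be an integer, $F_q^*$ the multiplicative group of reduced residues modulo $q$ (inverses $a^{-1}$ are taken in it), $\phi$ Euler's function, $C_q$ the set of non-principal Dirichlet characters modulo $q$, $\pi(x)$ the number of primes $\le x$. For complex $\rho$ with $\Re\rho>0$ and $x\ge 2$ put $$f(\rho)=\frac{x^{\rho}}{\rho\log x}+\frac1\rho\int_2^x\frac{t^\rho}{t\log^2 t}\,dt .$$ A system $\mathcal B$ (modulo $q$) assigns to each $\chi\in C_q$ a sequence $B(\chi)$ (possibly empty, repetitions allowed) of complex numbers with non-negative imaginary part; $n(\rho,\chi)$ is the number of occurrences of $\rho$ in $B(\chi)$ (0 if it does not occur). If $\rho$ is real it is required that $n(\rho,\chi)=n(\rho,\overline\chi)$. Put $R^+(\mathcal B)=\sup\{\Re\rho:\rho\in\mathcal B\}$, $R^-(\mathcal B)=\inf\{\Re\rho:\rho\in\mathcal B\}$. It is always assumed that $\frac12<R^-(\mathcal B)\le R^+(\mathcal B)\le 1$ and $\sum_{\chi\in C_q}\sum_{\rho\in B(\chi)} n(\rho,\chi)/|\rho|<\infty$ (sums are over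 distinct $\rho$). Define $$P_{q,a}(x;\mathcal B)=-\frac{2}{\phi(q)}\Re\Big(\sum_{\chi\in C_q}\overline\chi(a)\sum_{\rho\in B(\chi)}w(\rho)\,n(\rho,\chi) f(\rho)\Big)+\frac{\pi(x)}{\phi(q)},$$ where the inner sum is over distinct $\rho$, $w(\rho)=\frac12$ if $\rho$ is real and $w(\rho)=1$ otherwise. A family $\mathcal F=(F_{q,a})_{a\in F_q^*}$ of functions $[0,\infty)\to\mathbb R$ is $\beta$-similar to $\mathcal P_q=(P_{q,a}(\cdot;\mathcal B))_{a\in F_q^*}$ if $|F_{q,a}(x)-P_{q,a}(x;\mathcal B)|=o(x^\beta/\log x)$ as $x\to\infty$ for every $a$. For a statement $\mathcal I(\mathcal F)$ about such families, $\mathcal B$ is a barrier for $\mathcal I$ if, with $\beta=R^-(\mathcal B)$, for every $\mathcal F$ that is $\beta$-similar to $\mathcal P_q$ the statement $\mathcal I(\mathcal F)$ is false. For $a,b\in F_q^*$ let $g(\rho;a,b)=\sum_{\chi\in C_q}n(\rho,\chi)(\chi(a)-\chi(b))$, $\beta(a,b)=\sup\{\Re\rho: g(\rho;a,b)\ne0\}$, and $z(a,b)=\bigcup_{\chi\in C_q}\{\rho\in B(\chi): g(\rho;a,b)\ne 0,\ \Re\rho=\beta(a,b)\}$. *)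

theory Defs
  imports
    "HOL-Analysis.Analysis"
    "HOL-Number_Theory.Number_Theory"
    "HOL-Library.Landau_Symbols"
begin

abbreviation reduced_residues :: "nat \<Rightarrow> int monoid" where
  "reduced_residues q \<equiv> units_of (residue_ring (int q))"

text \<open>
  Characters are extended by zero and periodically to all integers, so that distinct characters
  are distinct functions.
\<close>

definition dirichlet_character :: "nat \<Rightarrow> (int \<Rightarrow> complex) \<Rightarrow> bool" where
  "dirichlet_character q \<psi> \<longleftrightarrow>
     (\<forall>a b. \<psi> (a * b) = \<psi> a * \<psi> b) \<and>
     (\<forall>a. \<psi> (a + int q) = \<psi> a) \<and>
     (\<forall>a. \<psi> a = 0 \<longleftrightarrow> \<not> coprime a (int q))"

definition principal_character :: "nat \<Rightarrow> int \<Rightarrow> complex" where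
  "principal_character q a = (if coprime a (int q) then 1 else 0)"

definition nonprincipal_characters :: "nat \<Rightarrow> (int \<Rightarrow> complex) set" where
  "nonprincipal_characters q = {\<psi>. dirichlet_character q \<psi> \<and> \<psi> \<noteq> principal_character q}"

definition prime_pi :: "real \<Rightarrow> nat" where
  "prime_pi x = card {p :: nat. prime p \<and> real p \<le> x}"

definition f_term :: "real \<Rightarrow> complex \<Rightarrow> complex" where
  "f_term x \<rho> =
     of_real x powr \<rho> / (\<rho> * of_real (ln x)) +
     1 / \<rho> * integral {2..x} (\<lambda>t. of_real t powr \<rho> / of_real (t * (ln t)\<^sup>2))"

text \<open>
  A finite (possibly empty) or infinite sequence is a partial function on the natural numbers
  whose domain is an initial segment; its range is the set of its distinct terms.
  A value of a system outside the set of non-principal characters carries no meaning.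
\<close>

type_synonym char_system = "(int \<Rightarrow> complex) \<Rightarrow> nat \<rightharpoonup> complex"

definition is_sequence :: "(nat \<rightharpoonup> complex) \<Rightarrow> bool" where
  "is_sequence s \<longleftrightarrow> dom s = UNIV \<or> (\<exists>N. dom s = {..<N})"

text \<open>
  Since \<open>card\<close> is 0 on infinite sets, this is the number of occurrences only when that number
  is finite; this is guaranteed for systems below.
\<close>

definition mult_in :: "char_system \<Rightarrow> complex \<Rightarrow> (int \<Rightarrow> complex) \<Rightarrow> nat" where
  "mult_in B \<rho> \<psi> = card {k. B \<psi> k = Some \<rho>}"

definition system_points :: "nat \<Rightarrow> char_system \<Rightarrow> complex set" where
  "system_points q B = (\<Union>\<psi>\<in>nonprincipal_characters q. ran (B \<psi>))"

definition R_plus :: "nat \<Rightarrow> char_system \<Rightarrow> ereal" where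
  "R_plus q B = (SUP \<rho>\<in>system_points q B. ereal (Re \<rho>))"

definition R_minus :: "nat \<Rightarrow> char_system \<Rightarrow> ereal" where
  "R_minus q B = (INF \<rho>\<in>system_points q B. ereal (Re \<rho>))"

text \<open>
  The last conjunct says that the sum of \<open>n(\<rho>,\<psi>) / |\<rho>|\<close> over all \<open>\<psi>\<close> and all distinct \<open>\<rho>\<close> in
  \<open>B \<psi>\<close> is finite: there are only finitely many \<open>\<psi>\<close>, and finiteness of the sum
  includes finiteness of all multiplicities.
\<close>

definition is_system :: "nat \<Rightarrow> char_system \<Rightarrow> bool" where
  "is_system q B \<longleftrightarrow>
     (\<forall>\<psi>\<in>nonprincipal_characters q. is_sequence (B \<psi>) \<and> (\<forall>\<rho>\<in>ran (B \<psi>). Im \<rho> \<ge> 0)) \<and>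
     (\<forall>\<psi>\<in>nonprincipal_characters q. \<forall>\<rho>. \<rho> \<in> \<real> \<longrightarrow>
        mult_in B \<rho> \<psi> = mult_in B \<rho> (\<lambda>a. cnj (\<psi> a))) \<and>
     1 / 2 < R_minus q B \<and> R_minus q B \<le> R_plus q B \<and> R_plus q B \<le> 1 \<and>
     (\<forall>\<psi>\<in>nonprincipal_characters q.
        (\<forall>\<rho>. finite {k. B \<psi> k = Some \<rho>}) \<and>
        (\<lambda>\<rho>. real (mult_in B \<rho> \<psi>) / norm \<rho>) summable_on ran (B \<psi>))"

definition weight :: "complex \<Rightarrow> complex" where
  "weight \<rho> = (if \<rho> \<in> \<real> then 1 / 2 else 1)"

definition P_fun :: "nat \<Rightarrow> char_system \<Rightarrow> int \<Rightarrow> real \<Rightarrow> real" where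
  "P_fun q B a x =
     - 2 / real (totient q) *
       Re (\<Sum>\<psi>\<in>nonprincipal_characters q.
             cnj (\<psi> a) * (\<Sum>\<^sub>\<infinity>\<rho>\<in>ran (B \<psi>). weight \<rho> * of_nat (mult_in B \<rho> \<psi>) * f_term x \<rho>))
     + real (prime_pi x) / real (totient q)"

text \<open>
  A family of functions on the non-negative reals indexed by reduced residues is given by total
  functions. Only the indices in the carrier matter, and values at negative arguments are irrelevant.
\<close>

type_synonym race_family = "int \<Rightarrow> real \<Rightarrow> real"

definition similar_to :: "real \<Rightarrow> nat \<Rightarrow> race_family \<Rightarrow> char_system \<Rightarrow> bool" where
  "similar_to \<beta> q F B \<longleftrightarrow>
     (\<forall>a\<in>carrier (reduced_residues q).
        (\<lambda>x. \<bar>F a x - P_fun q B a x\<bar>) \<in> o[at_top](\<lambda>x. x powr \<beta> / ln x))"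

definition is_barrier :: "nat \<Rightarrow> char_system \<Rightarrow> (race_family \<Rightarrow> bool) \<Rightarrow> bool" where
  "is_barrier q B I \<longleftrightarrow>
     (\<forall>F. similar_to (real_of_ereal (R_minus q B)) q F B \<longrightarrow> \<not> I F)"

definition g_coeff :: "nat \<Rightarrow> char_system \<Rightarrow> complex \<Rightarrow> int \<Rightarrow> int \<Rightarrow> complex" where
  "g_coeff q B \<rho> a b =
     (\<Sum>\<psi>\<in>nonprincipal_characters q. of_nat (mult_in B \<rho> \<psi>) * (\<psi> a - \<psi> b))"

definition beta_sup :: "nat \<Rightarrow> char_system \<Rightarrow> int \<Rightarrow> int \<Rightarrow> ereal" where
  "beta_sup q B a b = (SUP \<rho>\<in>{\<rho>. g_coeff q B \<rho> a b \<noteq> 0}. ereal (Re \<rho>))"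

definition z_set :: "nat \<Rightarrow> char_system \<Rightarrow> int \<Rightarrow> int \<Rightarrow> complex set" where
  "z_set q B a b =
     (\<Union>\<psi>\<in>nonprincipal_characters q.
        {\<rho> \<in> ran (B \<psi>). g_coeff q B \<rho> a b \<noteq> 0 \<and> ereal (Re \<rho>) = beta_sup q B a b})"

end

theory Submission
  imports Defs "HOL-Real_Asymp.Real_Asymp"
begin

text \<open>
  Write \<open>S \<psi> x\<close> for the inner sum of weighted \<open>f(\<rho>)\<close> over \<open>B \<psi>\<close> (\<open>character_sum\<close>). Because \<open>\<psi> (inv a)\<close> is the
  conjugate of \<open>\<psi> a\<close>, averaging over \<open>a\<close> and its inverse replaces the character values by real
  numbers:
  \<open>P\<^sub>1(x) - (P\<^sub>a(x) + P\<^sub>c(x)) / 2 = - 2 / \<phi>(q) * (\<Sum>\<psi>. (1 - Re (\<psi> a)) * Re (S \<psi> x))\<close>, where \<open>c\<close> is the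
  inverse of \<open>a\<close>. All coefficients \<open>1 - Re (\<psi> a)\<close> are non-negative (\<open>P_fun_difference\<close>). Non-negativity
  also rules out cancellation in \<open>g(\<rho>; a, 1)\<close>: it is non-zero as soon as \<open>\<rho>\<close> occurs in \<open>B \<psi>\<close> for
  some \<open>\<psi>\<close> with \<open>\<psi> a \<noteq> 1\<close> (\<open>g_coeff_neq_0_iff\<close>). Hence the \<open>\<rho>\<close> that enter the difference for \<open>a\<close>
  are exactly those with \<open>g(\<rho>; a, 1) \<noteq> 0\<close>; their real parts are at most \<open>\<beta>(a, 1)\<close>, and \<open>z(a, 1) \<noteq> {}\<close>
  says that this maximum is attained.

  To make the difference negative it suffices to make the leading terms \<open>Re (x\<^sup>\<rho> / \<rho>)\<close> positive.
  The sum over all \<open>\<rho>\<close> of \<open>n(\<rho>, \<psi>) / |\<rho>|\<close> converges, so the main terms form an absolutely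
  convergent almost periodic function of \<open>ln x\<close>. By Dirichlet's theorem on simultaneous approximation
  there is a sequence \<open>x\<^sub>k\<close> tending to infinity along which \<open>x\<^sub>k\<close> to the power \<open>i Im \<rho>\<close> tends to 1
  for every \<open>\<rho>\<close> of the system at once (\<open>simultaneous_return_sequence\<close>). With \<open>b = \<beta>(a, 1)\<close>
  and \<open>\<psi> a \<noteq> 1\<close>, dominated convergence (\<open>tendsto_infsum_dominated\<close>) shows that along it \<open>S \<psi> x\<close> divided by
  \<open>x powr b / ln x\<close> tends to the sum of \<open>w(\<rho>) n(\<rho>, \<psi>) / \<rho>\<close> over the \<open>\<rho>\<close> with \<open>Re \<rho> = b\<close>
  (\<open>f_term_infsum_tendsto\<close>). Each of these terms has positive real part, so the
  normalised difference tends to a negative number (\<open>P_fun_difference_tendsto_neg\<close>).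
  The permitted perturbation of the \<open>P\<^sub>a\<close> is of smaller order because \<open>R\<^sup>-(B) \<le> \<beta>(a, 1)\<close>. One sequence
  serves all \<open>a \<in> D\<close> and \<open>D\<close> is finite, so from some \<open>k\<close> on the residue 1 loses to every \<open>a \<in> D\<close>.
\<close>

section \<open>Dirichlet characters\<close>

lemma reduced_residues_carrier:
  assumes "q \<ge> 2"
  shows "carrier (reduced_residues q) = {a. 0 < a \<and> a < int q \<and> coprime a (int q)}"
proof -
  interpret residues "int q" "residue_ring (int q)"
    using assms by unfold_locales auto
  show ?thesis by (simp add: units_of_carrier res_units_eq)
qed

lemma reduced_residues_inv:
  assumes "q \<ge> 2" and "a \<in> carrier (reduced_residues q)"
  defines "b \<equiv> inv\<^bsub>reduced_residues q\<^esub> a"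
  shows "b \<in> carrier (reduced_residues q)" and "a * b mod int q = 1"
proof -
  interpret residues "int q" "residue_ring (int q)"
    using assms by unfold_locales auto
  interpret U: group "reduced_residues q" by (rule units_group)
  show "b \<in> carrier (reduced_residues q)" using assms by simp
  have "a \<otimes>\<^bsub>reduced_residues q\<^esub> b = \<one>\<^bsub>reduced_residues q\<^esub>"
    using assms by (simp add: U.r_inv)
  then show "a * b mod int q = 1"
    by (simp add: units_of_mult units_of_one res_mult_eq res_one_eq)
qed

lemma nonprincipal_charactersD: "\<psi> \<in> nonprincipal_characters q \<Longrightarrow> dirichlet_character q \<psi>"
  by (simp add: nonprincipal_characters_def)

lemma dirichlet_character_mult: "dirichlet_character q \<psi> \<Longrightarrow> \<psi> (a * b) = \<psi> a * \<psi> b"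
  by (simp add: dirichlet_character_def)

lemma dirichlet_character_eq_0_iff:
  "dirichlet_character q \<psi> \<Longrightarrow> \<psi> a = 0 \<longleftrightarrow> \<not> coprime a (int q)"
  by (simp add: dirichlet_character_def)

lemma dirichlet_character_1: "dirichlet_character q \<psi> \<Longrightarrow> \<psi> 1 = 1"
  using dirichlet_character_mult[of q \<psi> 1 1] dirichlet_character_eq_0_iff[of q \<psi> 1] by simp

lemma dirichlet_character_power: "dirichlet_character q \<psi> \<Longrightarrow> \<psi> (a ^ n) = \<psi> a ^ n"
  by (induction n) (simp_all add: dirichlet_character_1 dirichlet_character_mult)

text \<open>The definition gives one step of the period; induction extends it to all integer multiples.\<close>

lemma dirichlet_character_mod:
  assumes "dirichlet_character q \<psi>"
  shows "\<psi> (a mod int q) = \<psi> a"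
proof -
  have up: "\<psi> (b + int q * int n) = \<psi> b" for b n
  proof (induction n)
    case (Suc n)
    have "b + int q * int (Suc n) = (b + int q * int n) + int q"
      by (simp add: algebra_simps)
    then show ?case
      using Suc assms unfolding dirichlet_character_def by metis
  qed simp
  have "\<psi> (b + int q * m) = \<psi> b" for b m
  proof (cases "m \<ge> 0")
    case True
    then show ?thesis using up[of b "nat m"] by simp
  next
    case False
    then show ?thesis using up[of "b + int q * m" "nat (- m)"] by simp
  qed
  from this[of "a mod int q" "a div int q"] show ?thesis by simp
qed

lemma dirichlet_character_root_of_unity:
  assumes "q \<ge> 2" "dirichlet_character q \<psi>" "coprime a (int q)"
  shows "\<psi> a ^ totient q = 1"
proof -
  interpret residues "int q" "residue_ring (int q)"
    using assms by unfold_locales auto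
  have "a ^ totient q mod int q = 1 mod int q"
    using euler_theorem[OF assms(3)] by (simp add: cong_def)
  then show ?thesis
    using dirichlet_character_mod[OF assms(2)] assms(2)
    by (metis dirichlet_character_1 dirichlet_character_power)
qed

lemma norm_dirichlet_character:
  assumes "q \<ge> 2" "dirichlet_character q \<psi>" "coprime a (int q)"
  shows "norm (\<psi> a) = 1"
proof -
  have "norm (\<psi> a) ^ totient q = 1"
    using dirichlet_character_root_of_unity[OF assms] by (metis norm_one norm_power)
  moreover have "totient q > 0" using assms(1) by simp
  ultimately show ?thesis
    using power_eq_imp_eq_base[of "norm (\<psi> a)" "totient q" 1] by simp
qed

lemma dirichlet_character_inverse:
  assumes "q \<ge> 2" "dirichlet_character q \<psi>" "coprime a (int q)" "a * b mod int q = 1"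
  shows "\<psi> b = cnj (\<psi> a)"
proof -
  have "\<psi> a * \<psi> b = 1"
    using dirichlet_character_mod[OF assms(2), of "a * b"] assms
    by (simp add: dirichlet_character_mult dirichlet_character_1)
  moreover have "\<psi> a * cnj (\<psi> a) = 1"
    using norm_dirichlet_character[OF assms(1-3)] by (simp add: complex_norm_square[symmetric])
  ultimately show ?thesis
    by (metis mult_cancel_left mult_zero_left zero_neq_one)
qed

text \<open>
  A character is determined by its values on \<open>{0..<q}\<close>, and each of these values is 0 or a root of
  unity of order dividing \<open>totient q\<close>.
\<close>

lemma finite_nonprincipal_characters:
  assumes "q \<ge> 2"
  shows "finite (nonprincipal_characters q)"
proof -
  define r where "r \<psi> = (\<lambda>a. if a \<in> {0..<int q} then \<psi> a else 0)" for \<psi> :: "int \<Rightarrow> complex"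
  define V where "V = insert 0 {z :: complex. z ^ totient q = 1}"
  have "finite V" unfolding V_def using assms by (auto intro!: finite_nth_roots)
  then have fin: "finite {f. \<forall>a. (a \<in> {0..<int q} \<longrightarrow> f a \<in> V) \<and> (a \<notin> {0..<int q} \<longrightarrow> f a = 0)}"
    by (intro finite_set_of_finite_funs) auto
  have "r ` nonprincipal_characters q \<subseteq> {f. \<forall>a. (a \<in> {0..<int q} \<longrightarrow> f a \<in> V) \<and> (a \<notin> {0..<int q} \<longrightarrow> f a = 0)}"
    using dirichlet_character_root_of_unity[OF assms] dirichlet_character_eq_0_iff
    by (auto simp: r_def V_def nonprincipal_characters_def)
  then have "finite (r ` nonprincipal_characters q)"
    using fin finite_subset by blast
  moreover have "inj_on r (nonprincipal_characters q)"
  proof (rule inj_onI, rule ext)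
    fix \<psi> \<psi>' a
    assume *: "\<psi> \<in> nonprincipal_characters q" "\<psi>' \<in> nonprincipal_characters q" "r \<psi> = r \<psi>'"
    have "a mod int q \<in> {0..<int q}" using assms by simp
    then have "\<psi> (a mod int q) = \<psi>' (a mod int q)"
      using fun_cong[OF *(3), of "a mod int q"] unfolding r_def by (simp only: if_True)
    then show "\<psi> a = \<psi>' a"
      using * by (simp add: nonprincipal_characters_def dirichlet_character_mod)
  qed
  ultimately show ?thesis by (rule finite_imageD)
qed

section \<open>Limits of infinite sums\<close>

text \<open>
  Tannery's theorem for unordered sums: by the Weierstrass test the majorant makes the finite partial
  sums converge uniformly in \<open>x\<close>, so the two limits can be interchanged.
\<close>

lemma tendsto_infsum_dominated:
  fixes f :: "'a \<Rightarrow> 'b \<Rightarrow> 'c :: banach"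
  assumes lim: "\<And>i. i \<in> A \<Longrightarrow> (f i \<longlongrightarrow> l i) G"
    and bound: "\<forall>\<^sub>F x in G. \<forall>i\<in>A. norm (f i x) \<le> M i"
    and M: "M summable_on A"
    and G: "G \<noteq> bot"
  shows "l summable_on A" and "((\<lambda>x. \<Sum>\<^sub>\<infinity>i\<in>A. f i x) \<longlongrightarrow> (\<Sum>\<^sub>\<infinity>i\<in>A. l i)) G"
proof -
  have "norm (l i) \<le> M i" if "i \<in> A" for i
  proof (rule tendsto_upperbound)
    show "((\<lambda>x. norm (f i x)) \<longlongrightarrow> norm (l i)) G"
      using lim[OF that] by (rule tendsto_norm)
    show "\<forall>\<^sub>F x in G. norm (f i x) \<le> M i"
      using bound by eventually_elim (use that in auto)
  qed (rule G)
  then show l: "l summable_on A"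
    using Infinite_Sum.abs_summable_on_comparison_test'[OF M] by (metis abs_summable_summable)
  define Y where "Y = {x. \<forall>i\<in>A. norm (f i x) \<le> M i}"
  show "((\<lambda>x. \<Sum>\<^sub>\<infinity>i\<in>A. f i x) \<longlongrightarrow> (\<Sum>\<^sub>\<infinity>i\<in>A. l i)) G"
  proof (rule swap_uniform_limit')
    show "((\<lambda>X. \<Sum>i\<in>X. l i) \<longlongrightarrow> (\<Sum>\<^sub>\<infinity>i\<in>A. l i)) (finite_subsets_at_top A)"
      using has_sum_infsum[OF l] unfolding has_sum_def .
    have "\<forall>\<^sub>F X in finite_subsets_at_top A. X \<subseteq> A"
      by (auto simp: eventually_finite_subsets_at_top)
    then show "\<forall>\<^sub>F X in finite_subsets_at_top A. ((\<lambda>x. \<Sum>i\<in>X. f i x) \<longlongrightarrow> (\<Sum>i\<in>X. l i)) G"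
      by eventually_elim (auto intro!: tendsto_sum lim)
    show "uniform_limit Y (\<lambda>X x. \<Sum>i\<in>X. f i x) (\<lambda>x. \<Sum>\<^sub>\<infinity>i\<in>A. f i x) (finite_subsets_at_top A)"
      by (rule Weierstrass_m_test_general[where f = f, OF _ M]) (simp add: Y_def)
    show "\<forall>\<^sub>F x in G. x \<in> Y" using bound by (simp add: Y_def)
  qed auto
qed

section \<open>Simultaneous returns of a countable set of frequencies\<close>

lemma norm_cis_2pi_le:
  "norm (cis (2 * pi * (real_of_int m + d)) - 1) \<le> 2 * pi * \<bar>d\<bar>"
proof -
  have "cis (2 * pi * (real_of_int m + d)) = cis (2 * pi * real_of_int m) * cis (2 * pi * d)"
    by (simp only: distrib_left cis_mult)
  then have "cis (2 * pi * (real_of_int m + d)) = cis (2 * pi * d)"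
    by (simp add: cis_multiple_2pi)
  then show ?thesis
    using dist_exp_i_1[of "2 * pi * d"] abs_sin_x_le_abs_x[of "pi * d"]
    by (simp add: cis_conv_exp abs_mult)
qed

text \<open>
  A diagonal argument: at stage \<open>k\<close> Dirichlet's theorem brings the first \<open>k\<close> frequencies of an
  enumeration within \<open>2 * pi / Suc k\<close> of their starting point.
\<close>

lemma simultaneous_return_sequence:
  fixes \<Gamma> :: "real set"
  assumes "countable \<Gamma>"
  obtains u :: "nat \<Rightarrow> real"
  where "filterlim u at_top sequentially" "\<And>\<gamma>. \<gamma> \<in> \<Gamma> \<Longrightarrow> (\<lambda>k. cis (\<gamma> * u k)) \<longlonglongrightarrow> 1"
proof -
  define g where "g = from_nat_into \<Gamma>"
  have "\<exists>v. v \<ge> real k \<and> (\<forall>i<k. norm (cis (g i * v) - 1) \<le> 2 * pi / real (Suc k))" for k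
  proof -
    \<comment> \<open>The factor \<open>k\<close> in the approximated numbers forces the return time \<open>k * m\<close> to be at least \<open>k\<close>.\<close>
    obtain m p where m: "0 < m" and
      p: "\<And>i. i < k \<Longrightarrow> \<bar>of_int m * (real k * g i / (2 * pi)) - of_int (p i)\<bar> < 1 / real (Suc k)"
      using Dirichlet_approx_simult[of "Suc k" k "\<lambda>i. real k * g i / (2 * pi)"] by blast
    define v where "v = real k * of_int m"
    have "v \<ge> real k"
      using m by (simp add: v_def mult_le_cancel_left1)
    moreover have "norm (cis (g i * v) - 1) \<le> 2 * pi / real (Suc k)" if "i < k" for i
    proof -
      define d where "d = of_int m * (real k * g i / (2 * pi)) - of_int (p i)"
      have "g i * v = 2 * pi * (of_int (p i) + d)"
        by (simp add: d_def v_def)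
      then have "norm (cis (g i * v) - 1) \<le> 2 * pi * \<bar>d\<bar>"
        using norm_cis_2pi_le by metis
      also have "\<dots> \<le> 2 * pi * (1 / real (Suc k))"
        using p[OF that] by (intro mult_left_mono) (auto simp: d_def)
      finally show ?thesis by simp
    qed
    ultimately show ?thesis by blast
  qed
  then obtain u where u: "\<And>k. u k \<ge> real k"
    and c: "\<And>k i. i < k \<Longrightarrow> norm (cis (g i * u k) - 1) \<le> 2 * pi / real (Suc k)"
    by metis
  show thesis
  proof
    show "filterlim u at_top sequentially"
      by (rule filterlim_at_top_mono[OF filterlim_real_sequentially]) (use u in auto)
    fix \<gamma> assume "\<gamma> \<in> \<Gamma>"
    then obtain i where i: "\<gamma> = g i"
      using from_nat_into_surj[OF assms] unfolding g_def by metis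
    have "(\<lambda>k. cis (\<gamma> * u k) - 1) \<longlonglongrightarrow> 0"
    proof (rule Lim_null_comparison)
      show "\<forall>\<^sub>F k in sequentially. norm (cis (\<gamma> * u k) - 1) \<le> 2 * pi / real (Suc k)"
        using eventually_gt_at_top[of i] by eventually_elim (unfold i, rule c)
      show "(\<lambda>k. 2 * pi / real (Suc k)) \<longlonglongrightarrow> 0" by real_asymp
    qed
    then show "(\<lambda>k. cis (\<gamma> * u k)) \<longlonglongrightarrow> 1" by (simp add: LIM_zero_iff)
  qed
qed

section \<open>Asymptotics of a single term\<close>

text \<open>
  \<open>main_size b\<close> is the order of magnitude of the first summand of \<open>f(\<rho>)\<close> for \<open>Re \<rho> = b\<close>, up to the
  factor \<open>1 / |\<rho>|\<close>; with the same factor, \<open>tail_size b\<close> majorizes the integral summand for all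
  \<open>\<rho>\<close> with \<open>Re \<rho> \<le> b\<close>.
\<close>

definition main_size :: "real \<Rightarrow> real \<Rightarrow> real" where
  "main_size b x = x powr b / ln x"

definition tail_size :: "real \<Rightarrow> real \<Rightarrow> real" where
  "tail_size b x = integral {2..x} (\<lambda>t. t powr (b - 1) / (ln t)\<^sup>2)"

lemma main_size_pos: "x \<ge> 2 \<Longrightarrow> main_size b x > 0"
  by (simp add: main_size_def)

text \<open>
  By L'Hospital's rule: the quotient of the derivatives is \<open>1 / (b * ln x - 1)\<close>.
\<close>

lemma tail_size_over_main_size:
  assumes "b > 0"
  shows "((\<lambda>x. tail_size b x / main_size b x) \<longlongrightarrow> 0) at_top"
proof (rule lhospital_at_top_at_top)
  show "filterlim (main_size b) at_top at_top"
    unfolding main_size_def using assms by real_asymp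
  show "\<forall>\<^sub>F x in at_top. (tail_size b has_real_derivative x powr (b - 1) / (ln x)\<^sup>2) (at x)"
    using eventually_gt_at_top[of 2]
  proof eventually_elim
    case (elim x)
    have "((\<lambda>x. integral {2..x} (\<lambda>t. t powr (b - 1) / (ln t)\<^sup>2))
            has_real_derivative x powr (b - 1) / (ln x)\<^sup>2) (at x within {2..x + 1})"
      by (rule integral_has_real_derivative) (use elim in \<open>auto intro!: continuous_intros\<close>)
    moreover have "at x within {2..x + 1} = at x"
      by (rule at_within_interior) (use elim in auto)
    ultimately show ?case by (simp add: tail_size_def[abs_def])
  qed
  show "\<forall>\<^sub>F x in at_top. (main_size b has_real_derivative
          x powr (b - 1) * (b / ln x - 1 / (ln x)\<^sup>2)) (at x)"
    using eventually_gt_at_top[of 2]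
  proof eventually_elim
    case (elim x)
    have "x powr b = x powr (b - 1) * x"
      using elim by (simp add: powr_diff)
    then show ?case
      unfolding main_size_def[abs_def] using elim
      by (auto intro!: derivative_eq_intros simp: field_simps power2_eq_square powr_diff)
  qed
  have "\<forall>\<^sub>F x in at_top. x powr (b - 1) * (b / ln x - 1 / (ln x)\<^sup>2) > 0"
    using assms by real_asymp
  then show "\<forall>\<^sub>F x in at_top. x powr (b - 1) * (b / ln x - 1 / (ln x)\<^sup>2) \<noteq> 0"
    by eventually_elim (rule less_imp_neq[THEN not_sym])
  show "((\<lambda>x. (x powr (b - 1) / (ln x)\<^sup>2) / (x powr (b - 1) * (b / ln x - 1 / (ln x)\<^sup>2))) \<longlongrightarrow> 0) at_top"
    using assms by real_asymp
qed

lemma norm_f_term_minus_main_le: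
  assumes "x \<ge> 2" "\<rho> \<noteq> 0" "Re \<rho> \<le> b"
  shows "norm (f_term x \<rho> - of_real x powr \<rho> / (\<rho> * of_real (ln x))) \<le> tail_size b x / norm \<rho>"
proof -
  define h where "h = (\<lambda>t. of_real t powr \<rho> / of_real (t * (ln t)\<^sup>2) :: complex)"
  have h: "h integrable_on {2..x}"
    unfolding h_def by (intro integrable_continuous_real continuous_intros) auto
  have k: "(\<lambda>t. t powr (b - 1) / (ln t)\<^sup>2) integrable_on {2..x}"
    by (intro integrable_continuous_real continuous_intros) auto
  have "norm (integral {2..x} h) \<le> tail_size b x"
    unfolding tail_size_def
  proof (rule integral_norm_bound_integral[OF h k])
    fix t assume t: "t \<in> {2..x}"
    have "norm (h t) = t powr Re \<rho> / (t * (ln t)\<^sup>2)"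
      using t by (simp add: h_def norm_divide norm_powr_real_powr norm_mult norm_power)
    also have "\<dots> \<le> t powr b / (t * (ln t)\<^sup>2)"
      using t assms by (intro divide_right_mono powr_mono) auto
    also have "\<dots> = t powr (b - 1) / (ln t)\<^sup>2"
      using t by (simp add: powr_diff)
    finally show "norm (h t) \<le> t powr (b - 1) / (ln t)\<^sup>2" .
  qed
  then have "norm (1 / \<rho> * integral {2..x} h) \<le> tail_size b x / norm \<rho>"
    by (simp add: norm_mult norm_divide divide_right_mono)
  then show ?thesis by (simp add: f_term_def h_def)
qed

lemma norm_f_term_le:
  assumes "x \<ge> 2" "\<rho> \<noteq> 0" "Re \<rho> \<le> b"
  shows "norm (f_term x \<rho>) \<le> (main_size b x + tail_size b x) / norm \<rho>"
proof -
  have "norm (of_real x powr \<rho> / (\<rho> * of_real (ln x))) = x powr Re \<rho> / (norm \<rho> * ln x)"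
    using assms by (simp add: norm_divide norm_mult norm_powr_real_powr)
  also have "\<dots> \<le> x powr b / (norm \<rho> * ln x)"
    using assms by (intro divide_right_mono powr_mono) auto
  also have "\<dots> = main_size b x / norm \<rho>"
    by (simp add: main_size_def)
  finally show ?thesis
    using norm_f_term_minus_main_le[OF assms] norm_triangle_sub[of "f_term x \<rho>" "of_real x powr \<rho> / (\<rho> * of_real (ln x))"]
    by (simp add: add_divide_distrib)
qed

lemma of_real_powr_polar:
  assumes "x > 0"
  shows "of_real x powr \<rho> = of_real (x powr Re \<rho>) * cis (Im \<rho> * ln x)"
proof -
  have "of_real x powr \<rho> = exp (\<rho> * of_real (ln x))"
    using assms by (simp add: powr_def Ln_of_real)
  also have "\<dots> = of_real (exp (Re \<rho> * ln x)) * cis (Im \<rho> * ln x)"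
    by (subst exp_eq_polar) simp
  finally show ?thesis
    using assms by (simp add: powr_def)
qed

text \<open>
  On a sequence along which the oscillating factor disappears, the term behaves like
  \<open>x powr (Re \<rho> - b) / \<rho>\<close> after normalisation; it survives only on the line \<open>Re \<rho> = b\<close>.
\<close>

lemma f_term_tendsto:
  fixes x :: "nat \<Rightarrow> real"
  assumes x: "filterlim x at_top sequentially"
    and c: "(\<lambda>k. cis (Im \<rho> * ln (x k))) \<longlonglongrightarrow> 1"
    and b: "b > 0" "\<rho> \<noteq> 0" "Re \<rho> \<le> b"
  shows "(\<lambda>k. f_term (x k) \<rho> / of_real (main_size b (x k))) \<longlonglongrightarrow> (if Re \<rho> = b then 1 / \<rho> else 0)"
proof -
  define m where "m k = of_real (x k powr (Re \<rho> - b)) * cis (Im \<rho> * ln (x k)) / \<rho>" for k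
  have ge2: "\<forall>\<^sub>F k in sequentially. x k \<ge> 2"
    using x by (simp add: filterlim_at_top)
  have m: "m \<longlonglongrightarrow> (if Re \<rho> = b then 1 / \<rho> else 0)"
  proof (cases "Re \<rho> = b")
    case True
    have "\<forall>\<^sub>F k in sequentially. cis (Im \<rho> * ln (x k)) / \<rho> = m k"
      using ge2 by eventually_elim (simp add: m_def True)
    moreover have "(\<lambda>k. cis (Im \<rho> * ln (x k)) / \<rho>) \<longlonglongrightarrow> 1 / \<rho>"
      using b(2) by (intro tendsto_intros c) auto
    ultimately show ?thesis
      using True by (auto intro: Lim_transform_eventually)
  next
    case False
    with b have "((\<lambda>y. y powr (Re \<rho> - b)) \<longlongrightarrow> 0) at_top"
      by real_asymp
    then have "(\<lambda>k. x k powr (Re \<rho> - b)) \<longlonglongrightarrow> 0"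
      using x by (rule filterlim_compose)
    then have "m \<longlonglongrightarrow> of_real 0 * 1 / \<rho>"
      unfolding m_def using b(2) by (intro tendsto_intros c) auto
    then show ?thesis using False by simp
  qed
  have "(\<lambda>k. f_term (x k) \<rho> / of_real (main_size b (x k)) - m k) \<longlonglongrightarrow> 0"
  proof (rule Lim_null_comparison)
    have "((\<lambda>y. tail_size b y / main_size b y / norm \<rho>) \<longlongrightarrow> 0) at_top"
      using tendsto_divide_zero[OF tail_size_over_main_size[OF b(1)]] .
    then show "(\<lambda>k. tail_size b (x k) / main_size b (x k) / norm \<rho>) \<longlonglongrightarrow> 0"
      using x by (rule filterlim_compose)
    show "\<forall>\<^sub>F k in sequentially. norm (f_term (x k) \<rho> / of_real (main_size b (x k)) - m k)
            \<le> tail_size b (x k) / main_size b (x k) / norm \<rho>"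
      using ge2
    proof eventually_elim
      case (elim k)
      have "of_real (x k) powr \<rho> = of_real (x k powr Re \<rho>) * cis (Im \<rho> * ln (x k))"
        using elim by (intro of_real_powr_polar) simp
      then have "of_real (x k) powr \<rho> / (\<rho> * of_real (ln (x k))) = m k * of_real (main_size b (x k))"
        using elim by (simp add: m_def main_size_def powr_diff)
      then have eq: "f_term (x k) \<rho> / of_real (main_size b (x k)) - m k
          = (f_term (x k) \<rho> - of_real (x k) powr \<rho> / (\<rho> * of_real (ln (x k)))) / of_real (main_size b (x k))"
        using main_size_pos[OF elim, of b] by (simp add: diff_divide_distrib)
      have "norm (f_term (x k) \<rho> / of_real (main_size b (x k)) - m k)
               = norm (f_term (x k) \<rho> - of_real (x k) powr \<rho> / (\<rho> * of_real (ln (x k)))) / main_size b (x k)"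
        using main_size_pos[OF elim, of b]
        by (subst eq) (simp add: norm_divide)
      also have "\<dots> \<le> (tail_size b (x k) / norm \<rho>) / main_size b (x k)"
        using norm_f_term_minus_main_le[OF elim b(2,3)] main_size_pos[OF elim, of b]
        by (intro divide_right_mono) auto
      finally show ?case by (simp add: field_simps)
    qed
  qed
  from tendsto_add[OF this m] show ?thesis by simp
qed

section \<open>The sum over one character\<close>

text \<open>
  The integral summand is eventually smaller than the main one, uniformly in \<open>\<rho>\<close>, so the normalised
  terms are dominated by \<open>2 * |w(\<rho>)| / |\<rho>|\<close>.
\<close>

lemma f_term_infsum_tendsto:
  fixes x :: "nat \<Rightarrow> real" and w :: "complex \<Rightarrow> complex"
  assumes x: "filterlim x at_top sequentially"
    and c: "\<And>\<rho>. \<rho> \<in> A \<Longrightarrow> (\<lambda>k. cis (Im \<rho> * ln (x k))) \<longlonglongrightarrow> 1"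
    and b: "b > 0" "\<And>\<rho>. \<rho> \<in> A \<Longrightarrow> \<rho> \<noteq> 0 \<and> Re \<rho> \<le> b"
    and w: "(\<lambda>\<rho>. norm (w \<rho>) / norm \<rho>) summable_on A"
  defines "l \<equiv> \<lambda>\<rho>. if Re \<rho> = b then w \<rho> / \<rho> else 0"
  shows "l summable_on A"
    and "(\<lambda>k. (\<Sum>\<^sub>\<infinity>\<rho>\<in>A. w \<rho> * f_term (x k) \<rho>) / of_real (main_size b (x k))) \<longlonglongrightarrow> (\<Sum>\<^sub>\<infinity>\<rho>\<in>A. l \<rho>)"
proof -
  define f where "f \<rho> k = w \<rho> * f_term (x k) \<rho> / of_real (main_size b (x k))" for \<rho> k
  have lim: "f \<rho> \<longlonglongrightarrow> l \<rho>" if "\<rho> \<in> A" for \<rho>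
  proof -
    have "(\<lambda>k. w \<rho> * (f_term (x k) \<rho> / of_real (main_size b (x k)))) \<longlonglongrightarrow> w \<rho> * (if Re \<rho> = b then 1 / \<rho> else 0)"
      using b that by (intro tendsto_intros f_term_tendsto x c) auto
    then show ?thesis by (simp add: f_def[abs_def] l_def if_distrib cong: if_cong)
  qed
  have M: "(\<lambda>\<rho>. 2 * (norm (w \<rho>) / norm \<rho>)) summable_on A"
    using w by (rule summable_on_cmult_right)
  have "\<forall>\<^sub>F y in at_top. tail_size b y / main_size b y < 1"
    using tail_size_over_main_size[OF b(1)] by (rule order_tendstoD) simp
  then have "\<forall>\<^sub>F k in sequentially. tail_size b (x k) / main_size b (x k) < 1"
    using x by (rule eventually_compose_filterlim)
  moreover have "\<forall>\<^sub>F k in sequentially. x k \<ge> 2"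
    using x by (simp add: filterlim_at_top)
  ultimately have bound: "\<forall>\<^sub>F k in sequentially. \<forall>\<rho>\<in>A. norm (f \<rho> k) \<le> 2 * (norm (w \<rho>) / norm \<rho>)"
  proof eventually_elim
    case (elim k)
    note pos = main_size_pos[OF elim(2), of b]
    have "tail_size b (x k) \<le> main_size b (x k)" using elim(1) pos by simp
    then have le: "(main_size b (x k) + tail_size b (x k)) / main_size b (x k) \<le> 2"
      using pos by (simp add: field_simps)
    show ?case
    proof
      fix \<rho> assume "\<rho> \<in> A"
      with b(2) have \<rho>: "\<rho> \<noteq> 0" "Re \<rho> \<le> b" by auto
      have "norm (f \<rho> k) = norm (w \<rho>) * norm (f_term (x k) \<rho>) / main_size b (x k)"
        using pos by (simp add: f_def norm_mult norm_divide)
      also have "\<dots> \<le> norm (w \<rho>) * ((main_size b (x k) + tail_size b (x k)) / norm \<rho>) / main_size b (x k)"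
        using norm_f_term_le[OF elim(2) \<rho>] pos by (intro divide_right_mono mult_left_mono) auto
      also have "\<dots> = (main_size b (x k) + tail_size b (x k)) / main_size b (x k) * (norm (w \<rho>) / norm \<rho>)"
        by (simp add: mult.commute)
      also have "\<dots> \<le> 2 * (norm (w \<rho>) / norm \<rho>)"
        using le by (intro mult_right_mono) auto
      finally show "norm (f \<rho> k) \<le> 2 * (norm (w \<rho>) / norm \<rho>)" .
    qed
  qed
  note dom = tendsto_infsum_dominated[where A = A and f = f and l = l, OF lim bound M sequentially_bot]
  show "l summable_on A" by (rule dom(1))
  have "(\<Sum>\<^sub>\<infinity>\<rho>\<in>A. f \<rho> k) = (\<Sum>\<^sub>\<infinity>\<rho>\<in>A. w \<rho> * f_term (x k) \<rho>) / of_real (main_size b (x k))" for k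
    unfolding f_def divide_inverse by (rule infsum_cmult_left')
  with dom(2) show "(\<lambda>k. (\<Sum>\<^sub>\<infinity>\<rho>\<in>A. w \<rho> * f_term (x k) \<rho>) / of_real (main_size b (x k))) \<longlonglongrightarrow> (\<Sum>\<^sub>\<infinity>\<rho>\<in>A. l \<rho>)"
    by simp
qed

section \<open>Systems of characters\<close>

text \<open>The bounds in the definition of a system force the extended real \<open>R_minus q B\<close> to be finite.\<close>

lemma is_system_bounds:
  assumes "is_system q B"
  defines "\<beta> \<equiv> real_of_ereal (R_minus q B)"
  shows "\<beta> > 1 / 2" and "\<And>\<rho>. \<rho> \<in> system_points q B \<Longrightarrow> \<beta> \<le> Re \<rho>"
proof -
  have R: "1 / 2 < R_minus q B" "R_minus q B \<le> 1"
    using assms(1) unfolding is_system_def by auto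
  then have \<beta>: "ereal \<beta> = R_minus q B"
    unfolding \<beta>_def by (cases "R_minus q B") auto
  have "(1 / 2 :: ereal) = ereal (1 / 2)"
    by (metis ereal_divide numeral_eq_ereal one_ereal_def zero_neq_numeral)
  with R(1) show "\<beta> > 1 / 2" by (simp flip: \<beta>)
  fix \<rho> assume "\<rho> \<in> system_points q B"
  then have "R_minus q B \<le> ereal (Re \<rho>)"
    unfolding R_minus_def by (rule INF_lower)
  then show "\<beta> \<le> Re \<rho>" by (simp flip: \<beta>)
qed

lemma mult_in_pos_iff:
  assumes "is_system q B" "\<psi> \<in> nonprincipal_characters q"
  shows "mult_in B \<rho> \<psi> > 0 \<longleftrightarrow> \<rho> \<in> ran (B \<psi>)"
proof -
  have "finite {k. B \<psi> k = Some \<rho>}"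
    using assms unfolding is_system_def by blast
  then show ?thesis by (auto simp: mult_in_def card_gt_0_iff ran_def)
qed

lemma countable_system_points:
  assumes "q \<ge> 2"
  shows "countable (system_points q B)"
proof -
  have "countable (ran (B \<psi>))" for \<psi>
  proof (rule countable_subset)
    show "ran (B \<psi>) \<subseteq> (\<lambda>k. the (B \<psi> k)) ` UNIV"
      by (auto simp: ran_def image_iff) (metis option.sel)
  qed auto
  then show ?thesis
    unfolding system_points_def
    using finite_nonprincipal_characters[OF assms] by (auto intro: countable_finite)
qed

lemma Re_less_1_of_unimodular:
  assumes "norm (z :: complex) = 1" "z \<noteq> 1"
  shows "Re z < 1"
proof -
  have "Re z \<noteq> 1"
  proof
    assume "Re z = 1"
    with assms(1) have "Im z = 0" using cmod_power2[of z] by simp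
    with \<open>Re z = 1\<close> assms(2) show False by (simp add: complex_eq_iff)
  qed
  then show ?thesis using complex_Re_le_cmod[of z] assms(1) by simp
qed

text \<open>
  No cancellation is possible: \<open>- Re (\<psi> a - 1)\<close> is non-negative for every \<open>\<psi>\<close> and vanishes only
  if \<open>\<psi> a = 1\<close>.
\<close>

lemma g_coeff_neq_0_iff:
  assumes "q \<ge> 2" "coprime a (int q)"
  shows "g_coeff q B \<rho> a 1 \<noteq> 0 \<longleftrightarrow> (\<exists>\<psi>\<in>nonprincipal_characters q. mult_in B \<rho> \<psi> \<noteq> 0 \<and> \<psi> a \<noteq> 1)"
proof
  have one: "\<psi> 1 = 1" if "\<psi> \<in> nonprincipal_characters q" for \<psi>
    using that by (rule dirichlet_character_1[OF nonprincipal_charactersD])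
  assume "g_coeff q B \<rho> a 1 \<noteq> 0"
  then obtain \<psi> where "\<psi> \<in> nonprincipal_characters q" "of_nat (mult_in B \<rho> \<psi>) * (\<psi> a - \<psi> 1) \<noteq> 0"
    unfolding g_coeff_def by (meson sum.neutral)
  then show "\<exists>\<psi>\<in>nonprincipal_characters q. mult_in B \<rho> \<psi> \<noteq> 0 \<and> \<psi> a \<noteq> 1"
    using one by auto
next
  assume "\<exists>\<psi>\<in>nonprincipal_characters q. mult_in B \<rho> \<psi> \<noteq> 0 \<and> \<psi> a \<noteq> 1"
  then obtain \<psi>0 where \<psi>0: "\<psi>0 \<in> nonprincipal_characters q" "mult_in B \<rho> \<psi>0 \<noteq> 0" "\<psi>0 a \<noteq> 1"
    by blast
  have unit: "\<psi> 1 = 1" "norm (\<psi> a) = 1" if "\<psi> \<in> nonprincipal_characters q" for \<psi>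
    using dirichlet_character_1 norm_dirichlet_character[OF assms(1) _ assms(2)]
      nonprincipal_charactersD[OF that] by blast+
  have "0 < (\<Sum>\<psi>\<in>nonprincipal_characters q. real (mult_in B \<rho> \<psi>) * (1 - Re (\<psi> a)))"
  proof (rule sum_pos2[OF finite_nonprincipal_characters[OF assms(1)] \<psi>0(1)])
    show "0 < real (mult_in B \<rho> \<psi>0) * (1 - Re (\<psi>0 a))"
      using Re_less_1_of_unimodular[OF unit(2)[OF \<psi>0(1)] \<psi>0(3)] \<psi>0(2) by simp
    show "0 \<le> real (mult_in B \<rho> \<psi>) * (1 - Re (\<psi> a))" if "\<psi> \<in> nonprincipal_characters q" for \<psi>
      using complex_Re_le_cmod[of "\<psi> a"] unit(2)[OF that] by simp
  qed
  also have "\<dots> = - Re (g_coeff q B \<rho> a 1)"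
    unfolding g_coeff_def Re_sum by (simp add: unit(1) algebra_simps flip: sum_negf)
  finally show "g_coeff q B \<rho> a 1 \<noteq> 0" by auto
qed

section \<open>The race between 1 and the mean of a and its inverse\<close>

definition character_sum :: "char_system \<Rightarrow> (int \<Rightarrow> complex) \<Rightarrow> real \<Rightarrow> complex" where
  "character_sum B \<psi> x =
     (\<Sum>\<^sub>\<infinity>\<rho>\<in>ran (B \<psi>). weight \<rho> * of_nat (mult_in B \<rho> \<psi>) * f_term x \<rho>)"

text \<open>
  The terms with \<open>\<pi>(x)\<close> cancel, and \<open>\<psi>\<close> takes conjugate values at \<open>a\<close> and its inverse, so that their
  mean is \<open>Re (\<psi> a)\<close>.
\<close>

lemma P_fun_difference:
  assumes "q \<ge> 2" "a \<in> carrier (reduced_residues q)"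
  shows "P_fun q B 1 x - (P_fun q B a x + P_fun q B (inv\<^bsub>reduced_residues q\<^esub> a) x) / 2 =
    - 2 / real (totient q) *
      (\<Sum>\<psi>\<in>nonprincipal_characters q. (1 - Re (\<psi> a)) * Re (character_sum B \<psi> x))"
proof -
  define b where "b = inv\<^bsub>reduced_residues q\<^esub> a"
  define X where "X = nonprincipal_characters q"
  define S where "S c = (\<Sum>\<psi>\<in>X. Re (cnj (\<psi> c) * character_sum B \<psi> x))" for c
  have P: "P_fun q B c x = - 2 / real (totient q) * S c + real (prime_pi x) / real (totient q)" for c
    by (simp add: P_fun_def S_def X_def character_sum_def)
  have "coprime a (int q)" using assms by (simp add: reduced_residues_carrier)
  then have inv: "\<psi> b = cnj (\<psi> a)" "\<psi> 1 = 1" if "\<psi> \<in> X" for \<psi>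
    using that assms reduced_residues_inv(2)[OF assms]
    by (auto simp: X_def nonprincipal_characters_def b_def dirichlet_character_1
          intro!: dirichlet_character_inverse)
  have "S 1 - (S a + S b) / 2 = (\<Sum>\<psi>\<in>X. Re (cnj (\<psi> 1) * character_sum B \<psi> x)
      - (Re (cnj (\<psi> a) * character_sum B \<psi> x) + Re (cnj (\<psi> b) * character_sum B \<psi> x)) / 2)"
    by (simp only: S_def sum_subtractf sum.distrib flip: sum_divide_distrib)
  also have "\<dots> = (\<Sum>\<psi>\<in>X. (1 - Re (\<psi> a)) * Re (character_sum B \<psi> x))"
    by (rule sum.cong) (auto simp: inv algebra_simps)
  finally have "S 1 - (S a + S b) / 2 = (\<Sum>\<psi>\<in>X. (1 - Re (\<psi> a)) * Re (character_sum B \<psi> x))" .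
  moreover have "P_fun q B 1 x - (P_fun q B a x + P_fun q B b x) / 2
      = - 2 / real (totient q) * (S 1 - (S a + S b) / 2)"
  proof -
    have "m * s + p - ((m * t + p) + (m * u + p)) / 2 = m * (s - (t + u) / 2)" for m p s t u :: real
      by (simp add: algebra_simps add_divide_distrib)
    then show ?thesis unfolding P .
  qed
  ultimately show ?thesis by (simp add: X_def b_def)
qed

lemma norm_weight_le_1: "norm (weight \<rho>) \<le> 1"
  by (simp add: weight_def)

lemma Re_weighted_reciprocal_pos:
  assumes "Re \<rho> > 0" "n > 0"
  shows "Re (weight \<rho> * of_nat n / \<rho>) > 0"
proof -
  have "Re (of_nat n / \<rho>) > 0"
    using assms by (auto simp: Re_divide intro!: divide_pos_pos add_pos_nonneg)
  then show ?thesis using assms by (simp add: weight_def)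
qed

text \<open>
  Here \<open>b = \<beta>(a, 1)\<close>, which \<open>z(a, 1) \<noteq> {}\<close> makes a real number attained by some \<open>\<rho>0\<close> of the
  system. The limit is negative because all contributions from the line \<open>Re \<rho> = b\<close> are at most 0
  and that of \<open>\<rho>0\<close> is not 0.
\<close>

lemma P_fun_difference_tendsto_neg:
  fixes x :: "nat \<Rightarrow> real"
  assumes q: "q \<ge> 2" and a: "a \<in> carrier (reduced_residues q)"
    and B: "is_system q B"
    and z: "z_set q B a 1 \<noteq> {}"
    and x: "filterlim x at_top sequentially"
    and c: "\<And>\<rho>. \<rho> \<in> system_points q B \<Longrightarrow> (\<lambda>k. cis (Im \<rho> * ln (x k))) \<longlonglongrightarrow> 1"
  obtains b L where "real_of_ereal (R_minus q B) \<le> b" "L < 0"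
    "(\<lambda>k. (P_fun q B 1 (x k) -
             (P_fun q B a (x k) + P_fun q B (inv\<^bsub>reduced_residues q\<^esub> a) (x k)) / 2)
           / main_size b (x k)) \<longlonglongrightarrow> L"
proof -
  define X where "X = nonprincipal_characters q"
  have coprime: "coprime a (int q)" using a q by (simp add: reduced_residues_carrier)
  have unit: "norm (\<psi> a) = 1" if "\<psi> \<in> X" for \<psi>
    using that norm_dirichlet_character[OF q _ coprime] nonprincipal_charactersD
    unfolding X_def by blast
  have points: "\<rho> \<in> system_points q B" if "\<psi> \<in> X" "\<rho> \<in> ran (B \<psi>)" for \<psi> \<rho>
    using that by (auto simp: system_points_def X_def)
  have pos: "Re \<rho> > 0" if "\<rho> \<in> system_points q B" for \<rho>
    using is_system_bounds(1)[OF B] is_system_bounds(2)[OF B that] by linarith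
  from z obtain \<psi> \<rho>0 where \<rho>0: "\<psi> \<in> X" "\<rho>0 \<in> ran (B \<psi>)" "g_coeff q B \<rho>0 a 1 \<noteq> 0"
    "ereal (Re \<rho>0) = beta_sup q B a 1"
    unfolding z_set_def X_def by blast
  define b where "b = Re \<rho>0"
  have b: "b > 0" "real_of_ereal (R_minus q B) \<le> b"
    using pos is_system_bounds(2)[OF B] points[OF \<rho>0(1,2)] by (auto simp: b_def)
  have le_b: "Re \<rho> \<le> b" if "\<psi> \<in> X" "\<psi> a \<noteq> 1" "\<rho> \<in> ran (B \<psi>)" for \<psi> \<rho>
  proof -
    have "g_coeff q B \<rho> a 1 \<noteq> 0"
      using that mult_in_pos_iff[OF B, of \<psi> \<rho>] by (auto simp: g_coeff_neq_0_iff[OF q coprime] X_def)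
    then have "ereal (Re \<rho>) \<le> beta_sup q B a 1"
      unfolding beta_sup_def by (intro SUP_upper) simp
    then show ?thesis by (simp add: b_def flip: \<rho>0(4))
  qed
  define l where "l \<psi> \<rho> = (if Re \<rho> = b then weight \<rho> * of_nat (mult_in B \<rho> \<psi>) / \<rho> else 0)" for \<psi> \<rho>
  define L where "L \<psi> = (\<Sum>\<^sub>\<infinity>\<rho>\<in>ran (B \<psi>). l \<psi> \<rho>)" for \<psi>
  have L: "l \<psi> summable_on ran (B \<psi>)"
    "(\<lambda>k. character_sum B \<psi> (x k) / of_real (main_size b (x k))) \<longlonglongrightarrow> L \<psi>"
    if "\<psi> \<in> X" "\<psi> a \<noteq> 1" for \<psi>
  proof -
    have "(\<lambda>\<rho>. real (mult_in B \<rho> \<psi>) / norm \<rho>) summable_on ran (B \<psi>)"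
      using B that unfolding is_system_def X_def by blast
    then have "(\<lambda>\<rho>. norm (weight \<rho> * of_nat (mult_in B \<rho> \<psi>)) / norm \<rho>) summable_on ran (B \<psi>)"
    proof (rule summable_on_comparison_test)
      fix \<rho>
      show "norm (weight \<rho> * of_nat (mult_in B \<rho> \<psi>)) / norm \<rho> \<le> real (mult_in B \<rho> \<psi>) / norm \<rho>"
        using norm_weight_le_1[of \<rho>]
        by (intro divide_right_mono) (auto simp: norm_mult intro: mult_left_le_one_le)
    qed simp
    moreover have "\<rho> \<noteq> 0 \<and> Re \<rho> \<le> b" if "\<rho> \<in> ran (B \<psi>)" for \<rho>
      using le_b[of \<psi> \<rho>] pos[OF points[of \<psi> \<rho>]] that \<open>\<psi> \<in> X\<close> \<open>\<psi> a \<noteq> 1\<close> by auto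
    moreover have "(\<lambda>k. cis (Im \<rho> * ln (x k))) \<longlonglongrightarrow> 1" if "\<rho> \<in> ran (B \<psi>)" for \<rho>
      using c points \<open>\<psi> \<in> X\<close> that by blast
    ultimately show "l \<psi> summable_on ran (B \<psi>)"
      "(\<lambda>k. character_sum B \<psi> (x k) / of_real (main_size b (x k))) \<longlonglongrightarrow> L \<psi>"
      using f_term_infsum_tendsto[of x "ran (B \<psi>)" b "\<lambda>\<rho>. weight \<rho> * of_nat (mult_in B \<rho> \<psi>)"] x b(1)
      unfolding l_def L_def character_sum_def by blast+
  qed
  have l_nonneg: "Re (l \<psi> \<rho>) \<ge> 0" if "\<psi> \<in> X" "\<rho> \<in> ran (B \<psi>)" for \<psi> \<rho>
    using Re_weighted_reciprocal_pos[OF pos[OF points[OF that]]] mult_in_pos_iff[OF B, of \<psi> \<rho>] that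
    by (auto simp: l_def X_def intro: less_imp_le)
  have L_nonneg: "Re (L \<psi>) \<ge> 0" if "\<psi> \<in> X" "\<psi> a \<noteq> 1" for \<psi>
    unfolding L_def infsum_Re[OF L(1)[OF that], symmetric]
    by (intro infsum_nonneg l_nonneg that)
  define T where "T = (\<Sum>\<psi>\<in>X. (1 - Re (\<psi> a)) * Re (L \<psi>))"
  have "T > 0"
  proof -
    obtain \<psi>0 where \<psi>0: "\<psi>0 \<in> X" "mult_in B \<rho>0 \<psi>0 \<noteq> 0" "\<psi>0 a \<noteq> 1"
      using \<rho>0(3) by (auto simp: g_coeff_neq_0_iff[OF q coprime] X_def)
    then have ran: "\<rho>0 \<in> ran (B \<psi>0)"
      using mult_in_pos_iff[OF B] by (auto simp: X_def)
    have "Re (l \<psi>0 \<rho>0) > 0"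
      using Re_weighted_reciprocal_pos[OF pos[OF points[OF \<psi>0(1) ran]]] \<psi>0(2) by (simp add: l_def b_def)
    moreover have "Re (l \<psi>0 \<rho>0) \<le> Re (L \<psi>0)"
    proof -
      have "(\<Sum>\<^sub>\<infinity>\<rho>\<in>{\<rho>0}. Re (l \<psi>0 \<rho>)) \<le> (\<Sum>\<^sub>\<infinity>\<rho>\<in>ran (B \<psi>0). Re (l \<psi>0 \<rho>))"
        using ran l_nonneg[OF \<psi>0(1)] summable_on_Re[OF L(1)[OF \<psi>0(1,3)]]
        by (intro infsum_mono_neutral) auto
      then show ?thesis
        unfolding L_def using infsum_Re[OF L(1)[OF \<psi>0(1,3)]] by simp
    qed
    ultimately have "Re (L \<psi>0) > 0" by linarith
    show "T > 0"
      unfolding T_def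
    proof (rule sum_pos2)
      show "finite X" unfolding X_def by (rule finite_nonprincipal_characters[OF q])
      show "0 < (1 - Re (\<psi>0 a)) * Re (L \<psi>0)"
        using Re_less_1_of_unimodular[OF unit[OF \<psi>0(1)] \<psi>0(3)] \<open>Re (L \<psi>0) > 0\<close> by simp
      show "0 \<le> (1 - Re (\<psi> a)) * Re (L \<psi>)" if "\<psi> \<in> X" for \<psi>
        using Re_less_1_of_unimodular[OF unit[OF that]] L_nonneg[OF that]
        by (cases "\<psi> a = 1") auto
    qed (rule \<psi>0(1))
  qed
  \<comment> \<open>Characters with \<open>\<psi> a = 1\<close> may have points to the right of \<open>b\<close>, but their coefficient is 0.\<close>
  have lim1: "(\<lambda>k. (1 - Re (\<psi> a)) * Re (character_sum B \<psi> (x k)) / main_size b (x k)) \<longlonglongrightarrow> (1 - Re (\<psi> a)) * Re (L \<psi>)"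
    if "\<psi> \<in> X" for \<psi>
  proof (cases "\<psi> a = 1")
    case False
    have "(\<lambda>k. (1 - Re (\<psi> a)) * Re (character_sum B \<psi> (x k) / of_real (main_size b (x k)))) \<longlonglongrightarrow> (1 - Re (\<psi> a)) * Re (L \<psi>)"
      by (intro tendsto_intros L(2) that False)
    then show ?thesis by simp
  qed simp
  have "(\<lambda>k. - 2 / real (totient q) * (\<Sum>\<psi>\<in>X. (1 - Re (\<psi> a)) * Re (character_sum B \<psi> (x k)) / main_size b (x k))) \<longlonglongrightarrow> - 2 / real (totient q) * T"
    unfolding T_def by (intro tendsto_mult_left tendsto_sum lim1)
  then have "(\<lambda>k. (P_fun q B 1 (x k) -
             (P_fun q B a (x k) + P_fun q B (inv\<^bsub>reduced_residues q\<^esub> a) (x k)) / 2)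
           / main_size b (x k)) \<longlonglongrightarrow> - 2 / real (totient q) * T"
    unfolding P_fun_difference[OF q a] by (simp add: X_def mult.commute flip: sum_divide_distrib)
  moreover have "- 2 / real (totient q) * T < 0"
    using \<open>T > 0\<close> q by (intro mult_neg_pos) (auto simp: divide_neg_pos)
  ultimately show thesis using that b(2) by blast
qed

lemma similar_to_tendsto:
  assumes "similar_to \<beta> q F B" "c \<in> carrier (reduced_residues q)" "\<beta> \<le> b"
  shows "((\<lambda>x. (F c x - P_fun q B c x) / main_size b x) \<longlongrightarrow> 0) at_top"
proof (rule Lim_null_comparison)
  have "(\<lambda>x. \<bar>F c x - P_fun q B c x\<bar>) \<in> o[at_top](main_size \<beta>)"
    using assms(1,2) by (auto simp: similar_to_def main_size_def[abs_def])
  then show "((\<lambda>x. \<bar>F c x - P_fun q B c x\<bar> / main_size \<beta> x) \<longlongrightarrow> 0) at_top"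
    by (rule smalloD_tendsto)
  show "\<forall>\<^sub>F x in at_top. norm ((F c x - P_fun q B c x) / main_size b x)
      \<le> \<bar>F c x - P_fun q B c x\<bar> / main_size \<beta> x"
    using eventually_ge_at_top[of 2]
  proof eventually_elim
    case (elim x)
    have "main_size \<beta> x \<le> main_size b x"
      unfolding main_size_def using elim assms(3) by (intro divide_right_mono powr_mono) auto
    then show ?case
      using main_size_pos[OF elim, of \<beta>] main_size_pos[OF elim, of b]
      by (simp add: frac_le)
  qed
qed

theorem theorem3p1:
  fixes q :: nat and D :: "int set" and B :: char_system
  assumes "q \<ge> 3"
    and "D \<subseteq> carrier (reduced_residues q)"
    and "1 \<notin> D"
    and "is_system q B"
    and "\<And>a. a \<in> D \<Longrightarrow> z_set q B a 1 \<noteq> {}"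
  shows "is_barrier q B
    (\<lambda>F. \<forall>\<^sub>F x in at_top. \<exists>a\<in>D. F 1 x \<ge> (F a x + F (inv\<^bsub>reduced_residues q\<^esub> a) x) / 2)"
  unfolding is_barrier_def
proof (intro allI impI notI)
  fix F
  assume sim: "similar_to (real_of_ereal (R_minus q B)) q F B"
    and ev: "\<forall>\<^sub>F x in at_top. \<exists>a\<in>D. F 1 x \<ge> (F a x + F (inv\<^bsub>reduced_residues q\<^esub> a) x) / 2"
  have q: "q \<ge> 2" using assms(1) by simp
  have "countable (Im ` system_points q B)"
    using countable_system_points[OF q] by blast
  then obtain u :: "nat \<Rightarrow> real" where u: "filterlim u at_top sequentially"
    and cu: "\<And>\<gamma>. \<gamma> \<in> Im ` system_points q B \<Longrightarrow> (\<lambda>k. cis (\<gamma> * u k)) \<longlonglongrightarrow> 1"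
    by (rule simultaneous_return_sequence) blast
  define x where "x k = exp (u k)" for k
  have x: "filterlim x at_top sequentially"
    unfolding x_def by (rule filterlim_compose[OF exp_at_top u])
  have c: "(\<lambda>k. cis (Im \<rho> * ln (x k))) \<longlonglongrightarrow> 1" if "\<rho> \<in> system_points q B" for \<rho>
    using cu that by (simp add: x_def)
  have lose: "\<forall>\<^sub>F k in sequentially. F 1 (x k) < (F a (x k) + F (inv\<^bsub>reduced_residues q\<^esub> a) (x k)) / 2"
    if "a \<in> D" for a
  proof -
    define a' where "a' = inv\<^bsub>reduced_residues q\<^esub> a"
    have a: "a \<in> carrier (reduced_residues q)" using assms(2) that by blast
    have a': "a' \<in> carrier (reduced_residues q)"
      unfolding a'_def by (rule reduced_residues_inv(1)[OF q a])
    have one: "1 \<in> carrier (reduced_residues q)"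
      using q by (simp add: reduced_residues_carrier)
    have z: "z_set q B a 1 \<noteq> {}" using assms(5) that .
    obtain b L where b: "real_of_ereal (R_minus q B) \<le> b" and "L < 0" and
      L: "(\<lambda>k. (P_fun q B 1 (x k) - (P_fun q B a (x k) + P_fun q B a' (x k)) / 2) / main_size b (x k)) \<longlonglongrightarrow> L"
      using P_fun_difference_tendsto_neg[OF q a assms(4) z x c] unfolding a'_def by blast
    define e where "e d k = (F d (x k) - P_fun q B d (x k)) / main_size b (x k)" for d k
    have e: "e d \<longlonglongrightarrow> 0" if "d \<in> carrier (reduced_residues q)" for d
      unfolding e_def by (rule filterlim_compose[OF similar_to_tendsto[OF sim that b] x])
    have "(\<lambda>k. (P_fun q B 1 (x k) - (P_fun q B a (x k) + P_fun q B a' (x k)) / 2) / main_size b (x k)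
        + (e 1 k - (e a k + e a' k) / 2)) \<longlonglongrightarrow> L + (0 - (0 + 0) / 2)"
      by (intro tendsto_intros L e one a a') simp
    also have "(\<lambda>k. (P_fun q B 1 (x k) - (P_fun q B a (x k) + P_fun q B a' (x k)) / 2) / main_size b (x k)
        + (e 1 k - (e a k + e a' k) / 2)) = (\<lambda>k. (F 1 (x k) - (F a (x k) + F a' (x k)) / 2) / main_size b (x k))"
      unfolding e_def by (simp add: fun_eq_iff add_divide_distrib diff_divide_distrib)
    finally have "(\<lambda>k. (F 1 (x k) - (F a (x k) + F a' (x k)) / 2) / main_size b (x k)) \<longlonglongrightarrow> L"
      by simp
    then have "\<forall>\<^sub>F k in sequentially. (F 1 (x k) - (F a (x k) + F a' (x k)) / 2) / main_size b (x k) < 0"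
      using \<open>L < 0\<close> by (rule order_tendstoD)
    moreover have "\<forall>\<^sub>F k in sequentially. x k \<ge> 2"
      using x by (simp add: filterlim_at_top)
    ultimately show ?thesis
    proof eventually_elim
      case (elim k)
      then show ?case
        using main_size_pos[OF elim(2), of b] by (simp add: divide_less_0_iff a'_def)
    qed
  qed
  have "finite D"
    using assms(2) by (rule finite_subset) (auto simp: reduced_residues_carrier[OF q] intro: finite_subset[of _ "{0..int q}"])
  then have "\<forall>\<^sub>F k in sequentially. \<forall>a\<in>D. F 1 (x k) < (F a (x k) + F (inv\<^bsub>reduced_residues q\<^esub> a) (x k)) / 2"
    using lose by (simp add: eventually_ball_finite)
  moreover have "\<forall>\<^sub>F k in sequentially. \<exists>a\<in>D. F 1 (x k) \<ge> (F a (x k) + F (inv\<^bsub>reduced_residues q\<^esub> a) (x k)) / 2"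
    using ev x by (rule eventually_compose_filterlim)
  ultimately have "\<forall>\<^sub>F k in sequentially. False"
    by eventually_elim (auto simp: not_le[symmetric])
  then show False by simp
qed

end
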